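(* Let $(X,d)$ be a metric space, $Z$ a nonempty set, and $\mathcal{A}$ a nonempty subset of $X\times Z$ preordered by $\preceq$. Among the conditions (C0), (C'0), (Ca), (Cb), (C1), (C'1), (Ca1) on $(\mathcal{A},\preceq)$ defined in the context, the following relations hold: $$(\mathrm{C0})\iff(\mathrm{Ca})\wedge(\mathrm{Cb})\iff(\mathrm{Ca})\wedge(\mathrm{C1}),$$ $$(\mathrm{Cb})\Rightarrow(\mathrm{C1}),\qquad(\mathrm{C'0})\Rightarrow(\mathrm{C'1}),$$ $$(\mathrm{C'0})\Rightarrow(\mathrm{C0}),\qquad(\mathrm{C'1})\wedge(\mathrm{Ca1})\Rightarrow(\mathrm{C1}).$$ In general (C'1) does not imply (C1): there exist a metric space $(X,d)$, a nonempty set $Z$, and a nonempty subset $\mathcal{A}$ of $X\times Z$ preordered by a relation $\preceq$ for which (C'1) holds and (C1) fails. Moreover, the converses of the four implications $(\mathrm{Cb})\Rightarrow(\mathrm{C1})$, $(\mathrm{C'0})\Rightarrow(\mathrm{C'1})$, $(\mathrm{C'0})\Rightarrow(\mathrm{C0})$, $(\mathrm{C'1})\wedge(\mathrm{Ca1})\Rightarrow(\mathrm{C1})$ are not true in general, even if $(X,d)$ is complete and $Z$ is a singleton: for each of them there is a counterexample with $(X,d)$ complete and $Z$ a singleton.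
   Context: A preorder is a reflexive, transitive relation. A sequence $((x_n,z_n))_{n\ge1}\subset\mathcal{A}$ is $\preceq$-decreasing if $(x_{n+1},z_{n+1})\preceq(x_n,z_n)$ for all $n\ge1$. The conditions are: (C0) for every $\preceq$-decreasing sequence $((x_n,z_n))_{n\ge1}\subset\mathcal{A}$: $(x_n)$ is Cauchy and there is $(x,z)\in\mathcal{A}$ with $(x,z)\preceq(x_n,z_n)$ for all $n\ge1$. (C'0) for every $\preceq$-decreasing sequence $((x_n,z_n))_{n\ge1}\subset\mathcal{A}$ there is $(x,z)\in\mathcal{A}$ with $x_n\to x$ and $(x,z)\preceq(x_n,z_n)$ for all $n\ge1$. (Ca) for every $\preceq$-decreasing sequence $((x_n,z_n))_{n\ge1}\subset\mathcal{A}$: $(x_n)$ is Cauchy. (Cb) for every $\preceq$-decreasing sequence $((x_n,z_n))_{n\ge1}\subset\mathcal{A}$ there is $(x,z)\in\mathcal{A}$ with $(x,z)\preceq(x_n,z_n)$ for all $n\ge1$. (C1) for every $\preceq$-decreasing sequence $((x_n,z_n))_{n\ge1}\subset\mathcal{A}$ with $(x_n)$ Cauchy there is $(x,z)\in\mathcal{A}$ with $(x,z)\preceq(x_n,z_n)$ for all $n\ge1$. (C'1) for every $\preceq$-decreasing sequence $((x_n,z_n))_{n\ge1}\subset\mathcal{A}$ with $x_n\to x\in X$ there is $z\in Z$ with $(x,z)\in\mathcal{A}$ and $(x,z)\preceq(x_n,z_n)$ for all $n\ge1$. (Ca1) for every $\preceq$-decreasing sequence $((x_n,z_n))_{n\ge1}\subset\mathcal{A}$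 with $(x_n)$ Cauchy: $(x_n)$ is convergent in $X$. *)

theory Defs
  imports "HOL-Analysis.Analysis"
begin

text \<open>
  A metric space is a carrier set \<open>X\<close> with a distance \<open>d\<close> (\<^locale>\<open>Metric_space\<close>), so that one may
  quantify over metric spaces inside a formula. The relation \<open>r\<close> contains the pair \<open>(p, q)\<close> of
  elements of \<open>A\<close> iff \<open>p\<close> precedes \<open>q\<close>. Sequences are indexed from 0 instead of 1.
\<close>

definition preordered_subset ::
  "'a set \<Rightarrow> ('a \<Rightarrow> 'a \<Rightarrow> real) \<Rightarrow> 'b set \<Rightarrow> ('a \<times> 'b) set \<Rightarrow> ('a \<times> 'b) rel \<Rightarrow> bool" where
  "preordered_subset X d Z A r \<longleftrightarrow>
     Metric_space X d \<and> Z \<noteq> {} \<and> A \<noteq> {} \<and> A \<subseteq> X \<times> Z \<and> preorder_on A r"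

definition decreasing_seq :: "'c set \<Rightarrow> 'c rel \<Rightarrow> (nat \<Rightarrow> 'c) \<Rightarrow> bool" where
  "decreasing_seq A r s \<longleftrightarrow> range s \<subseteq> A \<and> (\<forall>n. (s (Suc n), s n) \<in> r)"

text \<open>A trailing prime is rendered by the suffix \<open>p\<close>: \<open>cond_Cp0\<close> is (C'0), \<open>cond_Cp1\<close> is (C'1).\<close>

definition cond_C0 ::
  "'a set \<Rightarrow> ('a \<Rightarrow> 'a \<Rightarrow> real) \<Rightarrow> ('a \<times> 'b) set \<Rightarrow> ('a \<times> 'b) rel \<Rightarrow> bool" where
  "cond_C0 X d A r \<longleftrightarrow> (\<forall>s. decreasing_seq A r s \<longrightarrow>
     Metric_space.MCauchy X d (\<lambda>n. fst (s n)) \<and>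
     (\<exists>x z. (x, z) \<in> A \<and> (\<forall>n. ((x, z), s n) \<in> r)))"

definition cond_Cp0 ::
  "'a set \<Rightarrow> ('a \<Rightarrow> 'a \<Rightarrow> real) \<Rightarrow> ('a \<times> 'b) set \<Rightarrow> ('a \<times> 'b) rel \<Rightarrow> bool" where
  "cond_Cp0 X d A r \<longleftrightarrow> (\<forall>s. decreasing_seq A r s \<longrightarrow>
     (\<exists>x z. (x, z) \<in> A \<and>
        limitin (Metric_space.mtopology X d) (\<lambda>n. fst (s n)) x sequentially \<and>
        (\<forall>n. ((x, z), s n) \<in> r)))"

definition cond_Ca ::
  "'a set \<Rightarrow> ('a \<Rightarrow> 'a \<Rightarrow> real) \<Rightarrow> ('a \<times> 'b) set \<Rightarrow> ('a \<times> 'b) rel \<Rightarrow> bool" where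
  "cond_Ca X d A r \<longleftrightarrow> (\<forall>s. decreasing_seq A r s \<longrightarrow>
     Metric_space.MCauchy X d (\<lambda>n. fst (s n)))"

definition cond_Cb :: "('a \<times> 'b) set \<Rightarrow> ('a \<times> 'b) rel \<Rightarrow> bool" where
  "cond_Cb A r \<longleftrightarrow> (\<forall>s. decreasing_seq A r s \<longrightarrow>
     (\<exists>x z. (x, z) \<in> A \<and> (\<forall>n. ((x, z), s n) \<in> r)))"

definition cond_C1 ::
  "'a set \<Rightarrow> ('a \<Rightarrow> 'a \<Rightarrow> real) \<Rightarrow> ('a \<times> 'b) set \<Rightarrow> ('a \<times> 'b) rel \<Rightarrow> bool" where
  "cond_C1 X d A r \<longleftrightarrow> (\<forall>s. decreasing_seq A r s \<and>
     Metric_space.MCauchy X d (\<lambda>n. fst (s n)) \<longrightarrow>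
     (\<exists>x z. (x, z) \<in> A \<and> (\<forall>n. ((x, z), s n) \<in> r)))"

definition cond_Cp1 ::
  "'a set \<Rightarrow> ('a \<Rightarrow> 'a \<Rightarrow> real) \<Rightarrow> 'b set \<Rightarrow> ('a \<times> 'b) set \<Rightarrow> ('a \<times> 'b) rel \<Rightarrow> bool" where
  "cond_Cp1 X d Z A r \<longleftrightarrow> (\<forall>s. \<forall>x\<in>X. decreasing_seq A r s \<and>
     limitin (Metric_space.mtopology X d) (\<lambda>n. fst (s n)) x sequentially \<longrightarrow>
     (\<exists>z\<in>Z. (x, z) \<in> A \<and> (\<forall>n. ((x, z), s n) \<in> r)))"

definition cond_Ca1 ::
  "'a set \<Rightarrow> ('a \<Rightarrow> 'a \<Rightarrow> real) \<Rightarrow> ('a \<times> 'b) set \<Rightarrow> ('a \<times> 'b) rel \<Rightarrow> bool" where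
  "cond_Ca1 X d A r \<longleftrightarrow> (\<forall>s. decreasing_seq A r s \<and>
     Metric_space.MCauchy X d (\<lambda>n. fst (s n)) \<longrightarrow>
     (\<exists>x\<in>X. limitin (Metric_space.mtopology X d) (\<lambda>n. fst (s n)) x sequentially))"

end

theory Submission
  imports Defs
begin

text \<open>
  All counterexamples are subsets \<open>S\<close> of the real line with \<open>Z = {0}\<close> and the usual order. A decreasing
  sequence in \<open>S\<close> either diverges to minus infinity or converges to its infimum. The set
  \<open>S = {0<..}\<close>, as a metric space of its own, has a Cauchy sequence without a lower bound, although every
  limit in \<open>S\<close> is one. In the complete space \<open>X = UNIV\<close>, the choice \<open>S = UNIV\<close> separates the conditions
  on convergent sequences from those on all sequences, while \<open>S = insert (-1) {0<..}\<close> is bounded below by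
  one of its elements but omits the limit \<open>0\<close> of some decreasing sequences.
\<close>

text \<open>\<open>limitin\<close> controls only the tail of a sequence, while
  \<open>MCauchy\<close> also demands that every term lie in the carrier. The inclusions
  \<open>range s \<subseteq> A\<close> and \<open>A \<subseteq> X \<times> Z\<close> supply
  this.\<close>

lemma mtopology_limit_imp_MCauchy:
  assumes "preordered_subset X d Z A r" "decreasing_seq A r s"
    and "limitin (Metric_space.mtopology X d) (\<lambda>n. fst (s n)) x sequentially"
  shows "Metric_space.MCauchy X d (\<lambda>n. fst (s n))"
proof -
  have "Metric_space X d" and sub: "range s \<subseteq> A" "A \<subseteq> X \<times> Z"
    using assms(1,2) by (simp_all add: preordered_subset_def decreasing_seq_def)
  moreover have "range (\<lambda>n. fst (s n)) \<subseteq> X"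
    using subset_trans[OF sub] by (simp add: image_subset_iff mem_Times_iff)
  ultimately show ?thesis
    using assms(3) by (blast intro: Metric_space.convergent_imp_MCauchy)
qed

lemma C0_iff_Ca_Cb: "cond_C0 X d A r \<longleftrightarrow> cond_Ca X d A r \<and> cond_Cb A r"
  unfolding cond_C0_def cond_Ca_def cond_Cb_def by blast

lemma Cb_imp_C1: "cond_Cb A r \<Longrightarrow> cond_C1 X d A r"
  unfolding cond_Cb_def cond_C1_def by blast

text \<open>Under (Ca) the Cauchy hypothesis of (C1) is automatic. Together with
  \<open>Cb_imp_C1\<close> this yields the second equivalence.\<close>

lemma Ca_C1_imp_Cb: "cond_Ca X d A r \<Longrightarrow> cond_C1 X d A r \<Longrightarrow> cond_Cb A r"
  unfolding cond_Ca_def cond_C1_def cond_Cb_def by blast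

lemma Cp0_imp_Cp1:
  assumes "preordered_subset X d Z A r" "cond_Cp0 X d A r"
  shows "cond_Cp1 X d Z A r"
  unfolding cond_Cp1_def
proof (intro allI ballI impI, elim conjE)
  fix s x
  assume s: "decreasing_seq A r s"
    and x: "limitin (Metric_space.mtopology X d) (\<lambda>n. fst (s n)) x sequentially"
  obtain y z where "(y, z) \<in> A" "\<forall>n. ((y, z), s n) \<in> r"
    and y: "limitin (Metric_space.mtopology X d) (\<lambda>n. fst (s n)) y sequentially"
    using assms(2) s unfolding cond_Cp0_def by blast
  \<comment> \<open>Limits in a metric space are unique, so the bound given by (C'0) sits over the
    prescribed limit.\<close>
  moreover have "y = x"
    using assms(1) Metric_space.limitin_metric_unique[OF _ y x]
    by (auto simp: preordered_subset_def)
  ultimately show "\<exists>z\<in>Z. (x, z) \<in> A \<and> (\<forall>n. ((x, z), s n) \<in> r)"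
    using assms(1) by (auto simp: preordered_subset_def)
qed

lemma Cp0_imp_C0:
  assumes "preordered_subset X d Z A r" "cond_Cp0 X d A r"
  shows "cond_C0 X d A r"
  unfolding cond_C0_def
proof (intro allI impI)
  fix s
  assume s: "decreasing_seq A r s"
  then obtain x z where "(x, z) \<in> A" "\<forall>n. ((x, z), s n) \<in> r"
    and "limitin (Metric_space.mtopology X d) (\<lambda>n. fst (s n)) x sequentially"
    using assms(2) unfolding cond_Cp0_def by blast
  then show "Metric_space.MCauchy X d (\<lambda>n. fst (s n)) \<and>
      (\<exists>x z. (x, z) \<in> A \<and> (\<forall>n. ((x, z), s n) \<in> r))"
    using mtopology_limit_imp_MCauchy[OF assms(1) s] by blast
qed

text \<open>(Ca1) provides a limit for each decreasing Cauchy sequence, and (C'1) provides a lower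
  bound over that limit.\<close>

lemma Cp1_Ca1_imp_C1:
  assumes "cond_Cp1 X d Z A r" "cond_Ca1 X d A r"
  shows "cond_C1 X d A r"
  using assms unfolding cond_Cp1_def cond_Ca1_def cond_C1_def by meson

text \<open>Both membership conditions make this a relation on \<open>S \<times> {0}\<close>, as
  \<open>preorder_on\<close> requires.\<close>

definition line_order :: "real set \<Rightarrow> (real \<times> nat) rel" where
  "line_order S = {(p, q). p \<in> S \<times> {0} \<and> q \<in> S \<times> {0} \<and> fst p \<le> fst q}"

text \<open>The carrier \<open>X\<close> may exceed \<open>S\<close>: one example uses the space
  \<open>S\<close> itself, the others the complete line.\<close>

lemma preordered_subset_line_order:
  assumes "S \<noteq> {}" "S \<subseteq> X"
  shows "preordered_subset X dist {0} (S \<times> {0}) (line_order S)"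
  using assms Met_TC.subspace[of X]
  by (auto simp: preordered_subset_def preorder_on_def refl_on_def trans_def line_order_def)

lemma decreasing_seq_line_order:
  "decreasing_seq (S \<times> {0}) (line_order S) s \<longleftrightarrow>
     range s \<subseteq> S \<times> {0} \<and> decseq (\<lambda>n. fst (s n))"
  by (auto simp: decreasing_seq_def line_order_def decseq_Suc_iff image_subset_iff mem_Times_iff)

lemma line_order_bound_iff:
  assumes "range s \<subseteq> S \<times> {0}"
  shows "(x, z) \<in> S \<times> {0} \<and> (\<forall>n. ((x, z), s n) \<in> line_order S) \<longleftrightarrow>
     x \<in> S \<and> z = 0 \<and> (\<forall>n. x \<le> fst (s n))"
  using assms by (auto simp: line_order_def image_subset_iff)

text \<open>A decreasing real sequence lies above its limit, so the limit is itself the bound.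
  Taking \<open>S\<close> as the carrier keeps it in \<open>S\<close>.\<close>

lemma Cp1_line_order: "cond_Cp1 S dist {0} (S \<times> {0}) (line_order S)"
  unfolding cond_Cp1_def decreasing_seq_line_order
proof (intro allI ballI impI, elim conjE)
  fix s :: "nat \<Rightarrow> real \<times> nat" and x
  assume s: "range s \<subseteq> S \<times> {0}" "decseq (\<lambda>n. fst (s n))" and x: "x \<in> S"
    and lim: "limitin (Metric_space.mtopology S dist) (\<lambda>n. fst (s n)) x sequentially"
  \<comment> \<open>Seen as a subspace of the line, \<open>S\<close> inherits ordinary
    convergence.\<close>
  interpret Submetric UNIV dist S
    by unfold_locales auto
  have "(\<lambda>n. fst (s n)) \<longlonglongrightarrow> x"
    using lim limitin_submetric_iff by auto
  then have "\<forall>n. x \<le> fst (s n)"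
    using decseq_ge[OF s(2)] by blast
  then show "\<exists>z\<in>{0}. (x, z) \<in> S \<times> {0} \<and> (\<forall>n. ((x, z), s n) \<in> line_order S)"
    using x line_order_bound_iff[OF s(1), of x 0] by simp
qed

text \<open>The carrier is the complete line, so a Cauchy sequence from \<open>S\<close> converges
  there, possibly outside \<open>S\<close>.\<close>

lemma Ca1_line_order: "cond_Ca1 UNIV dist (S \<times> {0}) (line_order S)"
  by (auto simp: cond_Ca1_def Cauchy_convergent_iff convergent_def)

lemma not_Cb_line_order_UNIV: "\<not> cond_Cb (UNIV \<times> {0}) (line_order UNIV)"
proof
  assume Cb: "cond_Cb (UNIV \<times> {0}) (line_order UNIV)"
  \<comment> \<open>This sequence tends to minus infinity, so a lower bound would contradict the
    Archimedean property.\<close>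
  let ?s = "\<lambda>n. (- real n, 0 :: nat)"
  have "decreasing_seq (UNIV \<times> {0}) (line_order UNIV) ?s"
    by (auto simp: decreasing_seq_line_order decseq_Suc_iff)
  then obtain x where "\<forall>n. x \<le> - real n"
    using Cb unfolding cond_Cb_def line_order_def by fastforce
  then show False
    using reals_Archimedean2[of "-x"] by (metis le_minus_iff not_le)
qed

text \<open>Test sequence for the sets that omit its limit 0. The \<open>Suc\<close> avoids the
  default value \<open>inverse 0 = 0\<close>.\<close>

lemma decreasing_seq_inverse_Suc:
  assumes "{0<..} \<subseteq> S"
  shows "decreasing_seq (S \<times> {0}) (line_order S) (\<lambda>n. (inverse (real (Suc n)), 0))"
proof -
  have "range (\<lambda>n. (inverse (real (Suc n)), 0)) \<subseteq> S \<times> {0}"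
    using assms by (auto simp: image_subset_iff subset_iff)
  then show ?thesis
    by (auto simp: decreasing_seq_line_order decseq_Suc_iff field_simps)
qed

lemma not_C1_line_order_pos: "\<not> cond_C1 {0<..} dist ({0<..} \<times> {0}) (line_order {0<..})"
proof
  assume C1: "cond_C1 {0<..} dist ({0<..} \<times> {0}) (line_order {0<..})"
  interpret Submetric UNIV dist "{0<..} :: real set"
    by unfold_locales auto
  have "Cauchy (\<lambda>n. inverse (real (Suc n)))"
    using LIMSEQ_inverse_real_of_nat by (rule LIMSEQ_imp_Cauchy)
  \<comment> \<open>The terms are positive, so the sequence stays Cauchy in the subspace, although
    its limit 0 is missing there.\<close>
  then have "sub.MCauchy (\<lambda>n. inverse (real (Suc n)))"
    by (auto simp: MCauchy_submetric)
  then obtain x z where "(x, z) \<in> {0<..} \<times> {0}"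
      "\<forall>n. ((x, z), inverse (real (Suc n)), 0) \<in> line_order {0<..}"
    using C1[unfolded cond_C1_def, rule_format, of "\<lambda>n. (inverse (real (Suc n)), 0)"]
      decreasing_seq_inverse_Suc[of "{0<..}"] by auto
  then have "0 < x" "\<forall>n. x \<le> inverse (real (Suc n))"
    by (auto simp: line_order_def)
  then show False
    by (meson not_le reals_Archimedean)
qed

text \<open>The least element bounds every decreasing sequence from below; monotone convergence then
  makes the sequence Cauchy on the line.\<close>

lemma C0_line_order_least:
  assumes "b \<in> S" "\<forall>x\<in>S. b \<le> x"
  shows "cond_C0 UNIV dist (S \<times> {0}) (line_order S)"
  unfolding cond_C0_def decreasing_seq_line_order
proof (intro allI impI conjI; elim conjE)
  fix s :: "nat \<Rightarrow> real \<times> nat"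
  assume s: "range s \<subseteq> S \<times> {0}" "decseq (\<lambda>n. fst (s n))"
  have b: "\<forall>n. b \<le> fst (s n)"
    using s(1) assms(2) by (auto simp: image_subset_iff mem_Times_iff)
  then show "\<exists>x z. (x, z) \<in> S \<times> {0} \<and> (\<forall>n. ((x, z), s n) \<in> line_order S)"
    using line_order_bound_iff[OF s(1), of b 0] assms(1) by (intro exI[of _ b] exI[of _ 0]) simp
  obtain l where "(\<lambda>n. fst (s n)) \<longlonglongrightarrow> l"
    using decseq_convergent[OF s(2) b] by blast
  then show "Met_TC.MCauchy (\<lambda>n. fst (s n))"
    unfolding MCauchy_iff_Cauchy by (rule LIMSEQ_imp_Cauchy)
qed

text \<open>(C'1) would demand a point of \<open>S \<times> {0}\<close> over 0, the limit of the
  test sequence.\<close>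

lemma not_Cp1_line_order:
  assumes "{0<..} \<subseteq> S" "0 \<notin> S"
  shows "\<not> cond_Cp1 UNIV dist {0} (S \<times> {0}) (line_order S)"
proof
  assume "cond_Cp1 UNIV dist {0} (S \<times> {0}) (line_order S)"
  then have "\<exists>z\<in>{0}. (0, z) \<in> S \<times> {0} \<and>
      (\<forall>n. ((0, z), inverse (real (Suc n)), 0) \<in> line_order S)"
    unfolding cond_Cp1_def
    using decreasing_seq_inverse_Suc[OF assms(1)] LIMSEQ_inverse_real_of_nat
    by (elim allE[of _ "\<lambda>n. (inverse (real (Suc n)), 0)"] ballE[of _ _ 0]) simp_all
  then show False
    using assms(2) by blast
qed

theorem proposition3p5:
  shows
    "(\<forall>(X :: 'a set) d (Z :: 'b set) A r. preordered_subset X d Z A r \<longrightarrow>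
        (cond_C0 X d A r \<longleftrightarrow> cond_Ca X d A r \<and> cond_Cb A r) \<and>
        (cond_Ca X d A r \<and> cond_Cb A r \<longleftrightarrow> cond_Ca X d A r \<and> cond_C1 X d A r) \<and>
        (cond_Cb A r \<longrightarrow> cond_C1 X d A r) \<and>
        (cond_Cp0 X d A r \<longrightarrow> cond_Cp1 X d Z A r) \<and>
        (cond_Cp0 X d A r \<longrightarrow> cond_C0 X d A r) \<and>
        (cond_Cp1 X d Z A r \<and> cond_Ca1 X d A r \<longrightarrow> cond_C1 X d A r)) \<and>
     (\<exists>(X :: real set) d (Z :: nat set) A r. preordered_subset X d Z A r \<and>
        cond_Cp1 X d Z A r \<and> \<not> cond_C1 X d A r) \<and>
     (\<exists>(X :: real set) d (Z :: nat set) A r. preordered_subset X d Z A r \<and>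
        Metric_space.mcomplete X d \<and> is_singleton Z \<and>
        cond_C1 X d A r \<and> \<not> cond_Cb A r) \<and>
     (\<exists>(X :: real set) d (Z :: nat set) A r. preordered_subset X d Z A r \<and>
        Metric_space.mcomplete X d \<and> is_singleton Z \<and>
        cond_Cp1 X d Z A r \<and> \<not> cond_Cp0 X d A r) \<and>
     (\<exists>(X :: real set) d (Z :: nat set) A r. preordered_subset X d Z A r \<and>
        Metric_space.mcomplete X d \<and> is_singleton Z \<and>
        cond_C0 X d A r \<and> \<not> cond_Cp0 X d A r) \<and>
     (\<exists>(X :: real set) d (Z :: nat set) A r. preordered_subset X d Z A r \<and>
        Metric_space.mcomplete X d \<and> is_singleton Z \<and>
        cond_C1 X d A r \<and> \<not> (cond_Cp1 X d Z A r \<and> cond_Ca1 X d A r))"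
proof (intro conjI)
  show "\<forall>(X :: 'a set) d (Z :: 'b set) A r. preordered_subset X d Z A r \<longrightarrow>
        (cond_C0 X d A r \<longleftrightarrow> cond_Ca X d A r \<and> cond_Cb A r) \<and>
        (cond_Ca X d A r \<and> cond_Cb A r \<longleftrightarrow> cond_Ca X d A r \<and> cond_C1 X d A r) \<and>
        (cond_Cb A r \<longrightarrow> cond_C1 X d A r) \<and>
        (cond_Cp0 X d A r \<longrightarrow> cond_Cp1 X d Z A r) \<and>
        (cond_Cp0 X d A r \<longrightarrow> cond_C0 X d A r) \<and>
        (cond_Cp1 X d Z A r \<and> cond_Ca1 X d A r \<longrightarrow> cond_C1 X d A r)"
    using C0_iff_Ca_Cb Cb_imp_C1 Ca_C1_imp_Cb Cp0_imp_Cp1 Cp0_imp_C0 Cp1_Ca1_imp_C1 by meson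
next
  show "\<exists>(X :: real set) d (Z :: nat set) A r. preordered_subset X d Z A r \<and>
        cond_Cp1 X d Z A r \<and> \<not> cond_C1 X d A r"
    \<comment> \<open>The carrier, left open by the rule, becomes \<open>{0<..}\<close>. An
      incomplete space is essential: completeness gives (Ca1), and (C'1) would then imply
      (C1).\<close>
    by (intro exI conjI, rule preordered_subset_line_order[of "{0<..}"])
      (auto intro: Cp1_line_order simp: not_C1_line_order_pos)
next
  \<comment> \<open>For \<open>S = UNIV\<close> the carriers of (C'1) and (Ca1) coincide, so the
    general implication applies.\<close>
  have C1: "cond_C1 UNIV dist (UNIV \<times> {0}) (line_order UNIV)"
    by (rule Cp1_Ca1_imp_C1[OF Cp1_line_order Ca1_line_order])
  show "\<exists>(X :: real set) d (Z :: nat set) A r. preordered_subset X d Z A r \<and>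
        Metric_space.mcomplete X d \<and> is_singleton Z \<and>
        cond_C1 X d A r \<and> \<not> cond_Cb A r"
    by (intro exI conjI, rule preordered_subset_line_order[OF UNIV_not_empty subset_UNIV])
      (use C1 not_Cb_line_order_UNIV in \<open>auto simp: complete_UNIV is_singleton_def\<close>)
next
  have not_Cp0: "\<not> cond_Cp0 UNIV dist (UNIV \<times> {0}) (line_order UNIV)"
    using not_Cb_line_order_UNIV unfolding cond_Cp0_def cond_Cb_def by blast
  show "\<exists>(X :: real set) d (Z :: nat set) A r. preordered_subset X d Z A r \<and>
        Metric_space.mcomplete X d \<and> is_singleton Z \<and>
        cond_Cp1 X d Z A r \<and> \<not> cond_Cp0 X d A r"
    by (intro exI conjI, rule preordered_subset_line_order[OF UNIV_not_empty subset_UNIV])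
      (use Cp1_line_order not_Cp0 in \<open>auto simp: complete_UNIV is_singleton_def\<close>)
next
  \<comment> \<open>One set refutes both remaining converses: the least element -1 gives (C0), hence
    (C1), while the missing 0 defeats (C'1), hence (C'0).\<close>
  let ?S = "insert (-1) {0<..} :: real set"
  have P: "preordered_subset UNIV dist {0} (?S \<times> {0}) (line_order ?S)"
    by (rule preordered_subset_line_order) auto
  have C0: "cond_C0 UNIV dist (?S \<times> {0}) (line_order ?S)"
    by (rule C0_line_order_least[of "-1"]) auto
  have not_Cp1: "\<not> cond_Cp1 UNIV dist {0} (?S \<times> {0}) (line_order ?S)"
    by (rule not_Cp1_line_order) auto
  show "\<exists>(X :: real set) d (Z :: nat set) A r. preordered_subset X d Z A r \<and>
        Metric_space.mcomplete X d \<and> is_singleton Z \<and>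
        cond_C0 X d A r \<and> \<not> cond_Cp0 X d A r"
    by (intro exI conjI, rule P)
      (use C0 not_Cp1 Cp0_imp_Cp1[OF P] in \<open>auto simp: complete_UNIV is_singleton_def\<close>)
  have C1: "cond_C1 UNIV dist (?S \<times> {0}) (line_order ?S)"
    using C0 unfolding cond_C0_def cond_C1_def by blast
  show "\<exists>(X :: real set) d (Z :: nat set) A r. preordered_subset X d Z A r \<and>
        Metric_space.mcomplete X d \<and> is_singleton Z \<and>
        cond_C1 X d A r \<and> \<not> (cond_Cp1 X d Z A r \<and> cond_Ca1 X d A r)"
    by (intro exI conjI, rule P)
      (use C1 not_Cp1 in \<open>auto simp: complete_UNIV is_singleton_def\<close>)
qed

end
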